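(* Let $G$ be an undirected, connected, loop-free multigraph with $n\ge 2$ vertices, genus $g\ge 1$ and stretch factor $\kappa$. Then for all integers $k\ge 1$, $$\gamma_{k,\mathbb{R}}(G)\le \left\lceil \frac{g(\kappa(k+1)-1)}{\kappa(k+1)}+k\right\rceil .$$
   Context: For a connected, loop-free multigraph $G=(V,E)$ with $n$ vertices and $m$ edges, the genus is $g=m-n+1$, and the stretch factor is $\kappa=\max\{\lceil n(n-1)/m\rceil,1\}$. An $\mathbb{R}$-divisor on $G$ is a formal sum $\sum_{v\in V}a_v(v)$ with $a_v\in\mathbb{R}$; its degree is $\sum_v a_v$; it is effective if $a_v\ge 0$ for all $v$. For $f:V\to\mathbb{Z}$ let $Q(f)=\sum_{v\in V}\big(\sum_{(u,v)\in E}(f(v)-f(u))\big)(v)$ (edges counted with multiplicity). Two $\mathbb{R}$-divisors $D_1,D_2$ are linearly equivalent if $D_1-D_2=Q(f)$ for some $f:V\to\mathbb{Z}$. The linear system $|D|$ is the set of effective $\mathbb{R}$-divisors linearly equivalent to $D$. The modified rank $\tilde r(D)$ is $k_0-1$, where $k_0$ is the infimum of all $k$ such that there is an effective $\mathbb{R}$-divisor $E$ of degree $k$ with $|D-E|=\emptyset$. The rank of $D$ is $r(D)=\tilde r\big(D+\sum_{v\in V}(v)\big)$. For an integer $k\ge 1$, the $k$-th $\mathbb{R}$-gonality $\gamma_{k,\mathbb{R}}(G)$ is the infimum of the degrees of all $\mathbb{R}$-divisors on $G$ of rank at least $k$. *)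

theory Defs
  imports Complex_Main "HOL-Library.Multiset" "HOL-Library.Indicator_Function"
begin

section \<open>Multigraphs\<close>

text \<open>
  An undirected loop-free multigraph is a finite vertex set together with a multiset of
  two-element subsets of it; the multiplicity of the edge \<open>{u, v}\<close> is \<open>count E {u, v}\<close>.
\<close>

definition multigraph :: "'a set \<Rightarrow> 'a set multiset \<Rightarrow> bool" where
  "multigraph V E \<longleftrightarrow> finite V \<and> (\<forall>e \<in># E. e \<subseteq> V \<and> card e = 2)"

definition adjacency :: "'a set multiset \<Rightarrow> ('a \<times> 'a) set" where
  "adjacency E = {(u, v). {u, v} \<in># E}"

definition connected_multigraph :: "'a set \<Rightarrow> 'a set multiset \<Rightarrow> bool" where
  "connected_multigraph V E \<longleftrightarrow>
     multigraph V E \<and> V \<noteq> {} \<and> (\<forall>u \<in> V. \<forall>v \<in> V. (u, v) \<in> (adjacency E)\<^sup>*)"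

definition genus :: "'a set \<Rightarrow> 'a set multiset \<Rightarrow> int" where
  "genus V E = int (size E) - int (card V) + 1"

definition stretch_factor :: "'a set \<Rightarrow> 'a set multiset \<Rightarrow> int" where
  "stretch_factor V E =
     max \<lceil>real (card V) * (real (card V) - 1) / real (size E)\<rceil> 1"


section \<open>Real divisors\<close>

text \<open>
  A formal sum over \<open>V\<close> is its coefficient function, extended by zero outside \<open>V\<close>.
\<close>

definition divisors :: "'a set \<Rightarrow> ('a \<Rightarrow> real) set" where
  "divisors V = {D. \<forall>v. v \<notin> V \<longrightarrow> D v = 0}"

definition div_degree :: "'a set \<Rightarrow> ('a \<Rightarrow> real) \<Rightarrow> real" where
  "div_degree V D = (\<Sum>v\<in>V. D v)"

definition effective_divisors :: "'a set \<Rightarrow> ('a \<Rightarrow> real) set" where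
  "effective_divisors V = {D \<in> divisors V. \<forall>v\<in>V. 0 \<le> D v}"

text \<open>
  Only the values of \<open>f\<close> on \<open>V\<close> matter.  The term \<open>u = v\<close> of the sum vanishes.
\<close>

definition principal_divisor ::
    "'a set \<Rightarrow> 'a set multiset \<Rightarrow> ('a \<Rightarrow> int) \<Rightarrow> 'a \<Rightarrow> real" where
  "principal_divisor V E f =
     (\<lambda>v. if v \<in> V then \<Sum>u\<in>V. real (count E {u, v}) * real_of_int (f v - f u) else 0)"

definition lin_equiv ::
    "'a set \<Rightarrow> 'a set multiset \<Rightarrow> ('a \<Rightarrow> real) \<Rightarrow> ('a \<Rightarrow> real) \<Rightarrow> bool" where
  "lin_equiv V E D1 D2 \<longleftrightarrow>
     (\<exists>f :: 'a \<Rightarrow> int. (\<lambda>v. D1 v - D2 v) = principal_divisor V E f)"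

definition linear_system ::
    "'a set \<Rightarrow> 'a set multiset \<Rightarrow> ('a \<Rightarrow> real) \<Rightarrow> ('a \<Rightarrow> real) set" where
  "linear_system V E D = {D' \<in> effective_divisors V. lin_equiv V E D' D}"


section \<open>Rank and gonality\<close>

text \<open>
  The infima below are taken in \<^typ>\<open>real\<close>; the lemmas in the last section show that
  for nonempty multigraphs both sets are nonempty and bounded below, so that they are
  genuine infima.
\<close>

definition rank_obstructions ::
    "'a set \<Rightarrow> 'a set multiset \<Rightarrow> ('a \<Rightarrow> real) \<Rightarrow> real set" where
  "rank_obstructions V E D =
     {k. \<exists>F \<in> effective_divisors V.
           div_degree V F = k \<and> linear_system V E (\<lambda>v. D v - F v) = {}}"

definition modified_rank :: "'a set \<Rightarrow> 'a set multiset \<Rightarrow> ('a \<Rightarrow> real) \<Rightarrow> real" where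
  "modified_rank V E D = Inf (rank_obstructions V E D) - 1"

definition div_rank :: "'a set \<Rightarrow> 'a set multiset \<Rightarrow> ('a \<Rightarrow> real) \<Rightarrow> real" where
  "div_rank V E D = modified_rank V E (\<lambda>v. D v + indicator V v)"

definition degrees_of_rank_ge ::
    "'a set \<Rightarrow> 'a set multiset \<Rightarrow> nat \<Rightarrow> real set" where
  "degrees_of_rank_ge V E k =
     div_degree V ` {D \<in> divisors V. real k \<le> div_rank V E D}"

definition real_gonality :: "'a set \<Rightarrow> 'a set multiset \<Rightarrow> nat \<Rightarrow> real" where
  "real_gonality V E k = Inf (degrees_of_rank_ge V E k)"


section \<open>The infima are well defined\<close>

lemma sum_principal_divisor: "(\<Sum>v\<in>V. principal_divisor V E f v) = 0"
proof -
  let ?c = "\<lambda>u v. real (count E {u, v}) * real_of_int (f v - f u)"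
  have "(\<Sum>v\<in>V. principal_divisor V E f v) = (\<Sum>v\<in>V. \<Sum>u\<in>V. ?c u v)"
    by (simp add: principal_divisor_def)
  moreover have "(\<Sum>v\<in>V. \<Sum>u\<in>V. ?c u v) = (\<Sum>v\<in>V. \<Sum>u\<in>V. ?c v u)"
    by (rule sum.swap)
  moreover have "(\<Sum>v\<in>V. \<Sum>u\<in>V. ?c v u) = - (\<Sum>v\<in>V. \<Sum>u\<in>V. ?c u v)"
    by (simp add: sum_negf[symmetric] insert_commute algebra_simps)
  ultimately show ?thesis by linarith
qed

lemma lin_equiv_degree:
  assumes "lin_equiv V E D1 D2"
  shows "div_degree V D1 = div_degree V D2"
proof -
  from assms obtain f where "(\<lambda>v. D1 v - D2 v) = principal_divisor V E f"
    unfolding lin_equiv_def by blast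
  then have "(\<Sum>v\<in>V. D1 v - D2 v) = 0"
    using sum_principal_divisor[of V E f] by (simp only:)
  then show ?thesis
    by (simp add: div_degree_def sum_subtractf)
qed

lemma linear_system_empty_if_degree_neg:
  assumes "div_degree V D < 0"
  shows "linear_system V E D = {}"
proof -
  have "0 \<le> div_degree V D'" if "D' \<in> effective_divisors V" for D'
    using that by (auto simp: effective_divisors_def div_degree_def intro: sum_nonneg)
  then show ?thesis
    using assms lin_equiv_degree by (fastforce simp: linear_system_def)
qed

lemma effective_in_linear_system:
  assumes "D \<in> effective_divisors V"
  shows "D \<in> linear_system V E D"
proof -
  have "(\<lambda>v. D v - D v) = principal_divisor V E (\<lambda>_. 0)"
    by (auto simp: principal_divisor_def)
  then show ?thesis
    using assms unfolding linear_system_def lin_equiv_def by blast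
qed

lemma rank_obstructions_bdd_below: "bdd_below (rank_obstructions V E D)"
  by (rule bdd_belowI[of _ 0])
    (auto simp: rank_obstructions_def effective_divisors_def div_degree_def intro: sum_nonneg)

lemma rank_obstructions_degree:
  assumes "finite V" "V \<noteq> {}" "0 \<le> k" "div_degree V D < k"
  shows "k \<in> rank_obstructions V E D"
proof -
  from assms obtain w where w: "w \<in> V" by blast
  let ?F = "\<lambda>v. if v = w then k else 0"
  have deg: "div_degree V ?F = k"
    using assms w by (simp add: div_degree_def)
  have "div_degree V (\<lambda>v. D v - ?F v) < 0"
    using deg assms by (simp add: div_degree_def sum_subtractf)
  moreover have "?F \<in> effective_divisors V"
    using w assms by (auto simp: effective_divisors_def divisors_def)
  ultimately show ?thesis
    using deg linear_system_empty_if_degree_neg unfolding rank_obstructions_def by blast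
qed

lemma rank_obstructions_nonempty:
  assumes "finite V" "V \<noteq> {}"
  shows "rank_obstructions V E D \<noteq> {}"
proof -
  have "max 0 (div_degree V D) + 1 \<in> rank_obstructions V E D"
    by (rule rank_obstructions_degree[OF assms]) (simp_all add: max_def)
  then show ?thesis by blast
qed

lemma degrees_of_rank_ge_nonempty:
  assumes "finite V" "V \<noteq> {}"
  shows "degrees_of_rank_ge V E k \<noteq> {}"
proof -
  let ?D = "\<lambda>v. (real k + 1) * indicator V v :: real"
  let ?D1 = "\<lambda>v. ?D v + indicator V v"
  have "real k + 1 \<le> Inf (rank_obstructions V E ?D1)"
  proof (rule cInf_greatest[OF rank_obstructions_nonempty[OF assms]])
    fix x assume "x \<in> rank_obstructions V E ?D1"
    then obtain F where F: "F \<in> effective_divisors V" "div_degree V F = x"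
        "linear_system V E (\<lambda>v. ?D1 v - F v) = {}"
      unfolding rank_obstructions_def by blast
    show "real k + 1 \<le> x"
    proof (rule ccontr)
      assume less: "\<not> real k + 1 \<le> x"
      have "F v \<le> x" if "v \<in> V" for v
        using F that assms
        by (auto simp: div_degree_def effective_divisors_def intro!: member_le_sum)
      then have "(\<lambda>v. ?D1 v - F v) \<in> effective_divisors V"
        using less F by (force simp: effective_divisors_def divisors_def)
      then show False
        using F(3) effective_in_linear_system by blast
    qed
  qed
  then have "real k \<le> div_rank V E ?D"
    by (simp add: div_rank_def modified_rank_def)
  moreover have "?D \<in> divisors V"
    by (simp add: divisors_def)
  ultimately show ?thesis
    unfolding degrees_of_rank_ge_def by blast
qed

lemma degrees_of_rank_ge_bdd_below:
  assumes "finite V" "V \<noteq> {}"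
  shows "bdd_below (degrees_of_rank_ge V E k)"
proof (rule bdd_belowI[of _ "- real (card V)"])
  fix x assume "x \<in> degrees_of_rank_ge V E k"
  then obtain D where D: "x = div_degree V D" "real k \<le> div_rank V E D"
    unfolding degrees_of_rank_ge_def by blast
  let ?D1 = "\<lambda>v. D v + indicator V v"
  have deg: "div_degree V ?D1 = x + real (card V)"
    using assms by (simp add: D(1) div_degree_def sum.distrib)
  show "- real (card V) \<le> x"
  proof (rule ccontr)
    assume "\<not> - real (card V) \<le> x"
    then have "0 \<in> rank_obstructions V E ?D1"
      using rank_obstructions_degree[OF assms, of 0 ?D1] deg by simp
    then have "Inf (rank_obstructions V E ?D1) \<le> 0"
      by (rule cInf_lower[OF _ rank_obstructions_bdd_below])
    then show False
      using D(2) by (simp add: div_rank_def modified_rank_def)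
  qed
qed

end

theory Submission
  imports Defs
begin

text \<open>
  Write \<open>m\<close> and \<open>n\<close> for the numbers of edges and vertices, \<open>a = k + 1\<close>, and let \<open>b\<close> be the
  integer part of \<open>g / (\<kappa> a)\<close>.  The bound to be shown is \<open>g + k - b = m - n + a - b\<close>.  Absorbing
  the summand \<open>\<Sum>\<^sub>v (v)\<close> of the definition of the rank, it suffices to find a divisor \<open>D\<close> of
  degree at most \<open>m + a - b\<close> such that \<open>|D - F|\<close> is nonempty for all effective \<open>F\<close> of degree
  less than \<open>a\<close>.

  There are two natural candidates.  The constant divisor with value \<open>a\<close> has this property for
  trivial reasons, as \<open>D - F\<close> is itself effective, and its degree \<open>n a\<close> is small enough when
  \<open>(n - 1) a + b \<le> m\<close>.  The second candidate is its dual, the divisor \<open>val - c\<close> with \<open>val\<close> the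
  vertex valencies and \<open>c = (m - a) / (n - 1)\<close>; it has degree \<open>m + a - c\<close>, which is small
  enough when \<open>a + (n - 1) b \<le> m\<close>.  An elementary computation (\<open>weighted_sum_le\<close>) shows
  that \<open>\<kappa> a b \<le> g\<close> and \<open>\<kappa> m \<ge> n (n - 1)\<close> imply the first inequality if \<open>1 \<le> a \<le> b\<close> and the
  second if \<open>1 \<le> b \<le> a\<close>.  If \<open>b = 0\<close>, every divisor of degree \<open>m + a\<close> works.

  The last two cases rest on \<open>empty_linear_system_dominated\<close>: if \<open>|D|\<close> is empty, then some
  divisor linearly equivalent to \<open>D\<close> lies strictly below the indegrees of an acyclic orientation
  of the graph.  Its proof is Dhar's burning algorithm applied to a \<open>q\<close>-reduced divisor.
  Since indegrees add up to \<open>m\<close>, this gives \<open>|D| \<noteq> {}\<close> whenever \<open>D\<close> has degree at least \<open>m\<close>.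
  For the dual candidate one combines it with the fact that for an acyclic orientation and any
  \<open>f\<close>, the divisor \<open>indeg + Q(f)\<close> is at least the valency at some vertex.
\<close>

section \<open>Valencies and acyclic orientations\<close>

definition valency :: "'a set \<Rightarrow> 'a set multiset \<Rightarrow> 'a \<Rightarrow> real" where
  "valency V E v = (\<Sum>u\<in>V. real (count E {u, v}))"

text \<open>
  An injective ranking \<open>\<sigma>\<close> of the vertices orients every edge towards its end of larger rank;
  all acyclic orientations arise in this way.  The following is the indegree of \<open>v\<close>.
\<close>

definition indegree :: "'a set \<Rightarrow> 'a set multiset \<Rightarrow> ('a \<Rightarrow> nat) \<Rightarrow> 'a \<Rightarrow> real" where
  "indegree V E \<sigma> v = (\<Sum>u\<in>V. if \<sigma> u < \<sigma> v then real (count E {u, v}) else 0)"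

lemma multigraph_count_loop:
  assumes "multigraph V E"
  shows "count E {v} = 0"
proof -
  have "{v} \<notin># E"
    using assms by (force simp: multigraph_def)
  then show ?thesis
    by (simp add: not_in_iff)
qed

lemma sum_valency:
  assumes "multigraph V E"
  shows "(\<Sum>v\<in>V. valency V E v) = 2 * real (size E)"
  using assms
proof (induction E)
  case empty
  then show ?case by (simp add: valency_def)
next
  case (add e E)
  have fin: "finite V" and e: "e \<subseteq> V" "card e = 2" and E: "multigraph V E"
    using add.prems by (auto simp: multigraph_def)
  obtain x y where xy: "e = {x, y}" "x \<noteq> y"
    using e(2) by (auto simp: card_2_iff)
  have "(\<Sum>v\<in>V. \<Sum>u\<in>V. if e = {u, v} then 1 else 0 :: real)
      = (\<Sum>v\<in>V. \<Sum>u\<in>V. (if v = y then if u = x then 1 else 0 else 0)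
                        + (if v = x then if u = y then 1 else 0 else 0))"
    using xy by (intro sum.cong refl) (auto simp: doubleton_eq_iff)
  also have "\<dots> = (\<Sum>v\<in>V. (if v = y then 1 else 0) + (if v = x then 1 else 0))"
    using fin e(1) xy(1) by (intro sum.cong refl) (auto simp: sum.distrib)
  also have "\<dots> = 2"
    using fin e(1) xy(1) by (simp add: sum.distrib)
  finally have two: "(\<Sum>v\<in>V. \<Sum>u\<in>V. if e = {u, v} then 1 else 0 :: real) = 2" .
  have "(\<Sum>v\<in>V. valency V (add_mset e E) v)
      = (\<Sum>v\<in>V. \<Sum>u\<in>V. real (count E {u, v}) + (if e = {u, v} then 1 else 0))"
    unfolding valency_def by (intro sum.cong refl) auto
  also have "\<dots> = 2 * real (size E) + 2"
    using add.IH[OF E] two by (simp add: sum.distrib valency_def)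
  finally show ?case by simp
qed

lemma sum_indegree:
  assumes "multigraph V E" "inj_on \<sigma> V"
  shows "(\<Sum>v\<in>V. indegree V E \<sigma> v) = real (size E)"
proof -
  let ?c = "\<lambda>u v. if \<sigma> u < \<sigma> v then real (count E {u, v}) else 0"
  have "2 * real (size E) = (\<Sum>v\<in>V. \<Sum>u\<in>V. ?c u v + ?c v u)"
    unfolding sum_valency[OF assms(1), symmetric] valency_def
  proof (intro sum.cong refl)
    fix u v assume "u \<in> V" "v \<in> V"
    then show "real (count E {u, v}) = ?c u v + ?c v u"
      using assms(2) multigraph_count_loop[OF assms(1)]
      by (cases "u = v") (auto simp: insert_commute inj_on_eq_iff linorder_neq_iff)
  qed
  also have "\<dots> = (\<Sum>v\<in>V. \<Sum>u\<in>V. ?c u v) + (\<Sum>v\<in>V. \<Sum>u\<in>V. ?c v u)"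
    by (simp only: sum.distrib)
  also have "(\<Sum>v\<in>V. \<Sum>u\<in>V. ?c v u) = (\<Sum>v\<in>V. \<Sum>u\<in>V. ?c u v)"
    by (rule sum.swap)
  finally show ?thesis
    by (simp add: indegree_def)
qed

text \<open>
  The vertex in question is a sink of the orientation restricted to the set where \<open>f\<close> is maximal:
  there \<open>Q(f)\<close> is at least the outdegree.
\<close>

lemma exists_valency_le_indegree_plus_principal:
  assumes "multigraph V E" "V \<noteq> {}" "inj_on \<sigma> V"
  obtains v where "v \<in> V" "valency V E v \<le> indegree V E \<sigma> v + principal_divisor V E f v"
proof -
  have fin: "finite V"
    using assms(1) by (simp add: multigraph_def)
  define A where "A = {v \<in> V. f v = Max (f ` V)}"
  have "Max (f ` V) \<in> f ` V"
    using fin assms(2) by (intro Max_in) auto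
  then have A: "finite A" "A \<noteq> {}"
    using fin by (auto simp: A_def)
  then have "Max (\<sigma> ` A) \<in> \<sigma> ` A"
    by (intro Max_in) auto
  then obtain v where v: "v \<in> A" "\<sigma> v = Max (\<sigma> ` A)"
    by auto
  have vV: "v \<in> V"
    using v(1) by (simp add: A_def)
  have le: "f u \<le> f v" if "u \<in> V" for u
    using v(1) fin that by (simp add: A_def)
  have lt: "f u < f v" if "u \<in> V" "\<sigma> v < \<sigma> u" for u
  proof -
    have "u \<notin> A"
      using that(2) v(2) A Max_ge[of "\<sigma> ` A" "\<sigma> u"] by auto
    then show ?thesis
      using le[OF that(1)] v(1) that(1) by (auto simp: A_def)
  qed
  have "valency V E v
      \<le> (\<Sum>u\<in>V. (if \<sigma> u < \<sigma> v then real (count E {u, v}) else 0)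
                 + real (count E {u, v}) * real_of_int (f v - f u))"
    unfolding valency_def
  proof (rule sum_mono)
    fix u assume u: "u \<in> V"
    consider "\<sigma> u < \<sigma> v" | "u = v" | "\<sigma> v < \<sigma> u"
      using assms(3) u vV by (meson inj_onD linorder_neqE_nat)
    then show "real (count E {u, v})
        \<le> (if \<sigma> u < \<sigma> v then real (count E {u, v}) else 0)
           + real (count E {u, v}) * real_of_int (f v - f u)"
    proof cases
      case 1
      then show ?thesis using le[OF u] by simp
    next
      case 2
      then show ?thesis using multigraph_count_loop[OF assms(1)] by simp
    next
      case 3
      then have "1 \<le> real_of_int (f v - f u)"
        using lt[OF u] by linarith
      then show ?thesis
        using 3 mult_left_mono[of 1 "real_of_int (f v - f u)" "real (count E {u, v})"] by simp
    qed
  qed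
  also have "\<dots> = indegree V E \<sigma> v + principal_divisor V E f v"
    using vV by (simp add: sum.distrib indegree_def principal_divisor_def)
  finally show ?thesis
    using that vV by blast
qed


section \<open>Principal divisors\<close>

lemma principal_divisor_add:
  "principal_divisor V E (\<lambda>u. f u + g u) v = principal_divisor V E f v + principal_divisor V E g v"
  by (simp add: principal_divisor_def sum.distrib[symmetric] algebra_simps)

lemma principal_divisor_scale:
  "principal_divisor V E (\<lambda>u. c * f u) v = real_of_int c * principal_divisor V E f v"
  by (simp add: principal_divisor_def sum_distrib_left algebra_simps)

lemma principal_divisor_uminus:
  "principal_divisor V E (\<lambda>u. - f u) v = - principal_divisor V E f v"
  using principal_divisor_scale[of V E "-1" f v] by simp

lemma principal_divisor_self_adjoint:
  "(\<Sum>v\<in>V. real_of_int (w v) * principal_divisor V E f v)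
    = (\<Sum>v\<in>V. principal_divisor V E w v * real_of_int (f v))"
proof -
  let ?c = "\<lambda>u v. real (count E {u, v})"
  have "(\<Sum>v\<in>V. real_of_int (w v) * principal_divisor V E f v)
      = (\<Sum>v\<in>V. \<Sum>u\<in>V. ?c u v * w v * f v) - (\<Sum>v\<in>V. \<Sum>u\<in>V. ?c u v * w v * f u)"
    by (simp add: principal_divisor_def sum_distrib_left sum_subtractf[symmetric] algebra_simps)
  also have "(\<Sum>v\<in>V. \<Sum>u\<in>V. ?c u v * w v * f u) = (\<Sum>v\<in>V. \<Sum>u\<in>V. ?c v u * w u * f v)"
    by (rule sum.swap)
  also have "(\<Sum>v\<in>V. \<Sum>u\<in>V. ?c u v * w v * f v) - (\<Sum>v\<in>V. \<Sum>u\<in>V. ?c v u * w u * f v)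
      = (\<Sum>v\<in>V. principal_divisor V E w v * real_of_int (f v))"
    by (simp add: principal_divisor_def sum_distrib_left sum_distrib_right
        sum_subtractf[symmetric] insert_commute algebra_simps)
  finally show ?thesis .
qed

lemma principal_divisor_indicator:
  assumes "finite V" "A \<subseteq> V" "v \<in> V"
  shows "principal_divisor V E (indicator A) v =
    (if v \<in> A then \<Sum>u\<in>V - A. real (count E {u, v}) else - (\<Sum>u\<in>A. real (count E {u, v})))"
proof (cases "v \<in> A")
  case True
  have "principal_divisor V E (indicator A) v
      = (\<Sum>u\<in>V. if u \<in> V - A then real (count E {u, v}) else 0)"
    using True assms(3) unfolding principal_divisor_def
    by (auto simp: indicator_def intro!: sum.cong)
  also have "\<dots> = (\<Sum>u\<in>V - A. real (count E {u, v}))"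
    using assms(1) by (intro sum.mono_neutral_cong_right) auto
  finally show ?thesis using True by simp
next
  case False
  have "principal_divisor V E (indicator A) v
      = - (\<Sum>u\<in>V. if u \<in> A then real (count E {u, v}) else 0)"
    using False assms(3) unfolding principal_divisor_def sum_negf[symmetric]
    by (auto simp: indicator_def intro!: sum.cong)
  also have "(\<Sum>u\<in>V. if u \<in> A then real (count E {u, v}) else 0)
      = (\<Sum>u\<in>A. real (count E {u, v}))"
    using assms by (simp add: sum.inter_restrict[symmetric] Int_absorb1)
  finally show ?thesis using False by simp
qed


section \<open>Reduced divisors and burning\<close>

text \<open>
  A potential \<open>w\<close> with \<open>Q(w) < 0\<close> away from \<open>q\<close>.  It shows both that chips can be moved until
  no vertex except possibly \<open>q\<close> is in debt, and that firing vertex sets which avoid \<open>q\<close> cannot go on forever.  It is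
  exponentially decreasing in the distance from \<open>q\<close>: a step towards \<open>q\<close> multiplies it by a
  number exceeding all valencies.
\<close>

lemma exists_subharmonic_potential:
  assumes "connected_multigraph V E" "q \<in> V"
  obtains w :: "'a \<Rightarrow> int" where
    "\<And>v. v \<in> V \<Longrightarrow> w v \<le> w q"
    "\<And>v. v \<in> V \<Longrightarrow> v \<noteq> q \<Longrightarrow> principal_divisor V E w v \<le> - 1"
proof -
  have mg: "multigraph V E" and fin: "finite V"
    using assms(1) by (auto simp: connected_multigraph_def multigraph_def)
  define h where "h v = (LEAST i. (q, v) \<in> adjacency E ^^ i)" for v
  define N where "N = (\<Sum>v\<in>V. h v)"
  define M :: int where "M = 2 * int (size E) + 1"
  define w :: "'a \<Rightarrow> int" where "w v = M ^ (N - h v)" for v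
  have M1: "1 \<le> M"
    by (simp add: M_def)
  have h_le_N: "h v \<le> N" if "v \<in> V" for v
    unfolding N_def using fin that by (intro member_le_sum) auto
  have hq: "h q = 0"
    unfolding h_def by (rule Least_eq_0) simp
  have "w v \<le> w q" for v
    unfolding w_def hq by (rule power_increasing) (use M1 in auto)
  moreover have "principal_divisor V E w v \<le> - 1" if v: "v \<in> V" "v \<noteq> q" for v
  proof -
    have "(q, v) \<in> (adjacency E)\<^sup>*"
      using assms v(1) by (auto simp: connected_multigraph_def)
    then have reach: "(q, v) \<in> adjacency E ^^ h v"
      unfolding h_def rtrancl_power by (rule LeastI_ex)
    have "h v \<noteq> 0"
    proof
      assume "h v = 0"
      then have "(q, v) \<in> adjacency E ^^ 0"
        using reach by (simp only:)
      then show False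
        using v(2) by simp
    qed
    then obtain i where i: "h v = Suc i"
      using not0_implies_Suc by blast
    then obtain u where u: "(q, u) \<in> adjacency E ^^ i" "(u, v) \<in> adjacency E"
      using reach by auto
    have uE: "{u, v} \<in># E"
      using u(2) by (simp add: adjacency_def)
    then have uV: "u \<in> V"
      using mg by (auto simp: multigraph_def)
    have hu: "h u \<le> i"
      unfolding h_def using u(1) by (rule Least_le)
    have "M * w v = M ^ (Suc (N - h v))"
      by (simp add: w_def)
    also have "\<dots> \<le> w u"
      unfolding w_def by (rule power_increasing) (use M1 hu i h_le_N[OF v(1)] in auto)
    finally have step: "M * w v \<le> w u" .
    have w1: "1 \<le> w x" for x
      unfolding w_def using M1 by (rule one_le_power)
    have "principal_divisor V E w v
        = valency V E v * w v - (\<Sum>x\<in>V. real (count E {x, v}) * w x)"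
      using v(1) by (simp add: principal_divisor_def valency_def sum_distrib_right
          sum_subtractf right_diff_distrib)
    moreover have "real_of_int (w u) \<le> real (count E {u, v}) * w u"
      using uE w1[of u] mult_right_mono[of 1 "real (count E {u, v})" "real_of_int (w u)"]
      by (simp add: Suc_le_eq)
    moreover have "real (count E {u, v}) * w u \<le> (\<Sum>x\<in>V. real (count E {x, v}) * w x)"
      using fin uV order_trans[OF zero_le_one w1] by (intro member_le_sum) auto
    moreover have "valency V E v \<le> real_of_int M - 1"
    proof -
      have "valency V E v \<le> (\<Sum>x\<in>V. valency V E x)"
        using fin v(1) by (intro member_le_sum) (auto simp: valency_def intro: sum_nonneg)
      then show ?thesis
        by (simp add: sum_valency[OF mg] M_def)
    qed
    then have "valency V E v * w v \<le> (real_of_int M - 1) * w v"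
      using w1[of v] by (intro mult_right_mono) auto
    moreover have "real_of_int (M * w v) \<le> real_of_int (w u)"
      using step by (simp only: of_int_le_iff)
    moreover have "1 \<le> real_of_int (w v)"
      using w1[of v] by simp
    ultimately show ?thesis
      by (simp add: algebra_simps)
  qed
  ultimately show ?thesis
    using that by blast
qed

text \<open>
  The burning algorithm: as long as every set \<open>A\<close> of unburnt vertices contains a vertex with
  fewer chips than burning edges, the vertices can be listed in the order in which they burn.
\<close>

lemma burning_order:
  fixes R :: "'a \<Rightarrow> real"
  assumes fin: "finite V"
    and burn: "\<And>A. A \<subseteq> V \<Longrightarrow> A \<noteq> {} \<Longrightarrow> \<exists>v\<in>A. R v < (\<Sum>u\<in>V - A. real (count E {u, v}))"
  obtains \<sigma> where "inj_on \<sigma> V" "\<And>v. v \<in> V \<Longrightarrow> R v < indegree V E \<sigma> v"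
proof -
  have "j \<le> card V \<Longrightarrow> \<exists>B \<sigma>. B \<subseteq> V \<and> card B = j \<and> inj_on \<sigma> B \<and> \<sigma> ` B \<subseteq> {..<j} \<and>
      (\<forall>v\<in>B. R v < indegree B E \<sigma> v)" for j
  proof (induction j)
    case 0
    show ?case
      by (rule exI[of _ "{}"]) simp
  next
    case (Suc j)
    then obtain B \<sigma> where B: "B \<subseteq> V" "card B = j" "inj_on \<sigma> B" "\<sigma> ` B \<subseteq> {..<j}"
        and R: "\<And>v. v \<in> B \<Longrightarrow> R v < indegree B E \<sigma> v"
      by (meson Suc_leD)
    have finB: "finite B"
      using B(1) fin by (rule finite_subset)
    have "V - B \<noteq> {}"
      using B Suc.prems by auto
    then obtain v where v: "v \<in> V" "v \<notin> B" "R v < (\<Sum>u\<in>V - (V - B). real (count E {u, v}))"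
      using burn[of "V - B"] by blast
    have "V - (V - B) = B"
      using B(1) by blast
    then have Rv: "R v < (\<Sum>u\<in>B. real (count E {u, v}))"
      using v(3) by simp
    define \<tau> where "\<tau> = \<sigma>(v := j)"
    have lt: "\<sigma> u < j" if "u \<in> B" for u
      using B(4) that by auto
    have \<tau>B: "\<tau> u = \<sigma> u" if "u \<in> B" for u
      using that v(2) by (auto simp: \<tau>_def)
    have \<tau>v: "\<tau> v = j"
      by (simp add: \<tau>_def)
    have inj: "inj_on \<tau> (insert v B)"
      using B(3) lt \<tau>B \<tau>v v(2) unfolding inj_on_def by (metis insert_iff less_irrefl)
    have im: "\<tau> ` insert v B \<subseteq> {..<Suc j}"
    proof
      fix y assume "y \<in> \<tau> ` insert v B"
      then show "y \<in> {..<Suc j}"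
        using \<tau>v \<tau>B less_SucI[OF lt] by fastforce
    qed
    have ineq: "R x < indegree (insert v B) E \<tau> x" if "x \<in> insert v B" for x
    proof (cases "x = v")
      case True
      have "indegree (insert v B) E \<tau> v = (\<Sum>u\<in>B. real (count E {u, v}))"
        using finB v(2) lt \<tau>B \<tau>v by (simp add: indegree_def)
      then show ?thesis using Rv True by simp
    next
      case False
      then have x: "x \<in> B" using that by simp
      then have "indegree (insert v B) E \<tau> x = indegree B E \<sigma> x"
        using finB v(2) lt[OF x] \<tau>B \<tau>v by (simp add: indegree_def)
      then show ?thesis using R[OF x] by simp
    qed
    have "insert v B \<subseteq> V" "card (insert v B) = Suc j"
      using B v finB by auto
    then show ?case
      using inj im ineq by blast
  qed
  from this[of "card V"] obtain B \<sigma> where "B \<subseteq> V" "card B = card V" "inj_on \<sigma> B"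
      "\<forall>v\<in>B. R v < indegree B E \<sigma> v"
    by auto
  moreover from this have "B = V"
    using fin by (simp add: card_subset_eq)
  ultimately show ?thesis
    using that by blast
qed

text \<open>
  Among the divisors equivalent to \<open>D\<close> and nonnegative away from a fixed vertex \<open>q\<close>, one whose
  pairing with the potential above is within 1 of the supremum is \<open>q\<close>-reduced.  If \<open>|D|\<close> is empty, it is
  negative at \<open>q\<close>, so that the fire starts there.
\<close>

lemma empty_linear_system_dominated:
  assumes conn: "connected_multigraph V E"
    and D: "D \<in> divisors V"
    and empty: "linear_system V E D = {}"
  obtains \<sigma> :: "'a \<Rightarrow> nat" and f :: "'a \<Rightarrow> int" where
    "inj_on \<sigma> V" "\<And>v. v \<in> V \<Longrightarrow> D v - principal_divisor V E f v < indegree V E \<sigma> v"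
proof -
  have fin: "finite V"
    using conn by (auto simp: connected_multigraph_def multigraph_def)
  obtain q where q: "q \<in> V"
    using conn by (auto simp: connected_multigraph_def)
  obtain w where w_le: "\<And>v. v \<in> V \<Longrightarrow> w v \<le> w q"
      and w_neg: "\<And>v. v \<in> V \<Longrightarrow> v \<noteq> q \<Longrightarrow> principal_divisor V E w v \<le> - 1"
    using exists_subharmonic_potential[OF conn q] by blast
  define R where "R f v = D v - principal_divisor V E f v" for f v
  define S where "S = {f. \<forall>v\<in>V - {q}. 0 \<le> R f v}"
  define \<Phi> where "\<Phi> f = (\<Sum>v\<in>V. real_of_int (w v) * R f v)" for f
  have deg_R: "(\<Sum>v\<in>V. R f v) = div_degree V D" for f
    by (simp add: R_def sum_subtractf sum_principal_divisor div_degree_def)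
  have S_nonempty: "S \<noteq> {}"
  proof -
    define c where "c = \<lceil>\<Sum>v\<in>V. \<bar>D v\<bar>\<rceil>"
    have "0 \<le> R (\<lambda>u. c * w u) v" if v: "v \<in> V" "v \<noteq> q" for v
    proof -
      have "\<bar>D v\<bar> \<le> (\<Sum>v\<in>V. \<bar>D v\<bar>)"
        using fin v(1) by (intro member_le_sum) auto
      then have c: "\<bar>D v\<bar> \<le> real_of_int c"
        unfolding c_def by linarith
      then have "real_of_int c * principal_divisor V E w v \<le> real_of_int c * (- 1)"
        using w_neg[OF v] by (intro mult_left_mono) auto
      then show ?thesis
        using c by (simp add: R_def principal_divisor_scale)
    qed
    then show ?thesis by (auto simp: S_def)
  qed
  have bdd: "bdd_above (\<Phi> ` S)"
  proof (rule bdd_aboveI2)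
    fix f assume f: "f \<in> S"
    have "\<Phi> f \<le> (\<Sum>v\<in>V. real_of_int (w q) * R f v)"
      unfolding \<Phi>_def
    proof (rule sum_mono)
      fix v assume "v \<in> V"
      then show "real_of_int (w v) * R f v \<le> real_of_int (w q) * R f v"
        using f w_le[of v] by (cases "v = q") (auto simp: S_def intro: mult_right_mono)
    qed
    then show "\<Phi> f \<le> real_of_int (w q) * div_degree V D"
      by (simp add: sum_distrib_left[symmetric] deg_R)
  qed
  obtain f where f: "f \<in> S" "Sup (\<Phi> ` S) - 1 < \<Phi> f"
  proof -
    have "\<exists>x\<in>\<Phi> ` S. Sup (\<Phi> ` S) - 1 < x"
      by (rule less_cSupD) (use S_nonempty in auto)
    then show ?thesis using that by auto
  qed
  have Rq: "R f q < 0"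
  proof (rule ccontr)
    assume "\<not> R f q < 0"
    then have "R f \<in> effective_divisors V"
      using f(1) D by (auto simp: S_def effective_divisors_def divisors_def R_def
          principal_divisor_def)
    moreover have "lin_equiv V E (R f) D"
      unfolding lin_equiv_def
      by (rule exI[of _ "\<lambda>u. - f u"]) (simp add: R_def fun_eq_iff principal_divisor_uminus)
    ultimately show False
      using empty by (auto simp: linear_system_def)
  qed
  have "\<exists>v\<in>A. R f v < (\<Sum>u\<in>V - A. real (count E {u, v}))" if A: "A \<subseteq> V" "A \<noteq> {}" for A
  proof (rule ccontr)
    assume "\<not> ?thesis"
    then have *: "(\<Sum>u\<in>V - A. real (count E {u, v})) \<le> R f v" if "v \<in> A" for v
      using that by force
    have "0 \<le> R f v" if "v \<in> A" for v
      using *[OF that] by (rule order_trans[OF sum_nonneg, rotated]) auto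
    then have qA: "q \<notin> A"
      using Rq by force
    \<comment> \<open>Firing \<open>A\<close> is legal and increases the pairing with \<open>w\<close> by at least 1.\<close>
    define g where "g u = f u + indicator A u" for u
    have R_g: "R g v = R f v - principal_divisor V E (indicator A) v" for v
      unfolding R_def g_def principal_divisor_add by simp
    have "0 \<le> R g v" if v: "v \<in> V" "v \<noteq> q" for v
    proof (cases "v \<in> A")
      case True
      then show ?thesis
        using *[OF True] by (simp add: R_g principal_divisor_indicator[OF fin A(1) v(1)])
    next
      case False
      have "0 \<le> R f v"
        using f(1) v by (auto simp: S_def)
      moreover have "0 \<le> (\<Sum>u\<in>A. real (count E {u, v}))"
        by (rule sum_nonneg) simp
      ultimately show ?thesis
        using False by (simp add: R_g principal_divisor_indicator[OF fin A(1) v(1)])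
    qed
    then have "g \<in> S"
      by (auto simp: S_def)
    then have "\<Phi> g \<le> Sup (\<Phi> ` S)"
      using bdd by (auto intro: cSup_upper)
    moreover have "\<Phi> g = \<Phi> f - (\<Sum>v\<in>A. principal_divisor V E w v)"
    proof -
      have "\<Phi> g = \<Phi> f - (\<Sum>v\<in>V. real_of_int (w v) * principal_divisor V E (indicator A) v)"
        by (simp add: \<Phi>_def R_g sum_subtractf[symmetric] algebra_simps)
      also have "(\<Sum>v\<in>V. real_of_int (w v) * principal_divisor V E (indicator A) v)
          = (\<Sum>v\<in>V. if v \<in> A then principal_divisor V E w v else 0)"
        unfolding principal_divisor_self_adjoint
        by (intro sum.cong) (auto simp: indicator_def)
      also have "\<dots> = (\<Sum>v\<in>A. principal_divisor V E w v)"
        using fin A(1) by (simp add: sum.inter_restrict[symmetric] Int_absorb1)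
      finally show ?thesis .
    qed
    moreover have "(\<Sum>v\<in>A. principal_divisor V E w v) \<le> - 1"
    proof -
      have finA: "finite A"
        using A(1) fin by (rule finite_subset)
      have "(\<Sum>v\<in>A. principal_divisor V E w v) \<le> (\<Sum>v\<in>A. - 1)"
        using A(1) qA w_neg by (intro sum_mono) auto
      moreover have "1 \<le> card A"
        using finA A(2) by (simp add: Suc_le_eq card_gt_0_iff)
      ultimately show ?thesis by simp
    qed
    ultimately show False
      using f(2) by linarith
  qed
  then obtain \<sigma> where "inj_on \<sigma> V" "\<And>v. v \<in> V \<Longrightarrow> R f v < indegree V E \<sigma> v"
    using burning_order[OF fin] by metis
  then show ?thesis
    using that[of \<sigma> f] by (simp add: R_def)
qed


section \<open>Divisors of large rank\<close>

lemma real_gonality_le: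
  assumes "finite V" "V \<noteq> {}" "D \<in> divisors V"
    and nonempty: "\<And>F. F \<in> effective_divisors V \<Longrightarrow> div_degree V F < real k + 1 \<Longrightarrow>
      linear_system V E (\<lambda>v. D v - F v) \<noteq> {}"
  shows "real_gonality V E k \<le> div_degree V D - real (card V)"
proof -
  define D0 where "D0 v = D v - indicator V v" for v
  have "(\<lambda>v. D0 v + indicator V v) = D"
    by (simp add: D0_def)
  moreover have "real k + 1 \<le> Inf (rank_obstructions V E D)"
  proof (rule cInf_greatest[OF rank_obstructions_nonempty[OF assms(1,2)]])
    fix x assume "x \<in> rank_obstructions V E D"
    then obtain F where "F \<in> effective_divisors V" "div_degree V F = x"
        "linear_system V E (\<lambda>v. D v - F v) = {}"
      unfolding rank_obstructions_def by blast
    then show "real k + 1 \<le> x"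
      using nonempty[of F] by (cases "x < real k + 1") auto
  qed
  ultimately have "real k \<le> div_rank V E D0"
    by (simp add: div_rank_def modified_rank_def)
  moreover have "D0 \<in> divisors V"
    using assms(3) by (simp add: divisors_def D0_def)
  ultimately have "div_degree V D0 \<in> degrees_of_rank_ge V E k"
    unfolding degrees_of_rank_ge_def by blast
  then have "real_gonality V E k \<le> div_degree V D0"
    unfolding real_gonality_def
    by (rule cInf_lower[OF _ degrees_of_rank_ge_bdd_below[OF assms(1,2)]])
  then show ?thesis
    using assms(1) by (simp add: D0_def div_degree_def sum_subtractf)
qed

lemma linear_system_nonempty_if_degree_ge:
  assumes "connected_multigraph V E" "D \<in> divisors V" "real (size E) \<le> div_degree V D"
  shows "linear_system V E D \<noteq> {}"
proof
  assume "linear_system V E D = {}"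
  then obtain \<sigma> f where \<sigma>: "inj_on \<sigma> V"
      "\<And>v. v \<in> V \<Longrightarrow> D v - principal_divisor V E f v < indegree V E \<sigma> v"
    using empty_linear_system_dominated[OF assms(1,2)] by blast
  have mg: "multigraph V E" "finite V" "V \<noteq> {}"
    using assms(1) by (auto simp: connected_multigraph_def multigraph_def)
  have "(\<Sum>v\<in>V. D v - principal_divisor V E f v) < (\<Sum>v\<in>V. indegree V E \<sigma> v)"
    using mg \<sigma>(2) by (intro sum_strict_mono) auto
  then show False
    using assms(3) by (simp add: sum_subtractf sum_principal_divisor sum_indegree[OF mg(1) \<sigma>(1)]
        div_degree_def)
qed

lemma real_gonality_le_trivial:
  assumes "connected_multigraph V E"
  shows "real_gonality V E k \<le> real (size E) + (real k + 1) - real (card V)"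
proof -
  have fin: "finite V" "V \<noteq> {}"
    using assms by (auto simp: connected_multigraph_def multigraph_def)
  then obtain q where q: "q \<in> V" by blast
  define D where "D v = (if v = q then real (size E) + (real k + 1) else 0)" for v
  have D: "D \<in> divisors V" "div_degree V D = real (size E) + (real k + 1)"
    using q fin(1) by (auto simp: D_def divisors_def div_degree_def)
  have "real_gonality V E k \<le> div_degree V D - real (card V)"
  proof (rule real_gonality_le[OF fin D(1)])
    fix F assume F: "F \<in> effective_divisors V" "div_degree V F < real k + 1"
    then have "div_degree V (\<lambda>v. D v - F v) = div_degree V D - div_degree V F"
      by (simp add: div_degree_def sum_subtractf)
    then show "linear_system V E (\<lambda>v. D v - F v) \<noteq> {}"
      using F D by (intro linear_system_nonempty_if_degree_ge[OF assms])
        (auto simp: divisors_def effective_divisors_def)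
  qed
  then show ?thesis by (simp add: D(2))
qed

lemma real_gonality_le_constant:
  assumes "finite V" "V \<noteq> {}"
  shows "real_gonality V E k \<le> real (card V) * (real k + 1) - real (card V)"
proof -
  define D where "D v = (real k + 1) * indicator V v" for v
  have "real_gonality V E k \<le> div_degree V D - real (card V)"
  proof (rule real_gonality_le[OF assms])
    show "D \<in> divisors V"
      by (simp add: D_def divisors_def)
  next
    fix F assume F: "F \<in> effective_divisors V" "div_degree V F < real k + 1"
    have "F v \<le> div_degree V F" if "v \<in> V" for v
      using F(1) assms(1) that
      by (auto simp: div_degree_def effective_divisors_def intro!: member_le_sum)
    then have "(\<lambda>v. D v - F v) \<in> effective_divisors V"
      using F by (force simp: effective_divisors_def divisors_def D_def)
    then show "linear_system V E (\<lambda>v. D v - F v) \<noteq> {}"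
      using effective_in_linear_system by blast
  qed
  also have "div_degree V D = real (card V) * (real k + 1)"
    using assms(1) by (simp add: div_degree_def D_def)
  finally show ?thesis .
qed

text \<open>
  The bound from the dual candidate \<open>D = val - c\<close>; the hypothesis determines \<open>c\<close>.  For an indegree
  divisor \<open>p\<close> shifted by a principal one, \<open>D - p\<close> has degree \<open>k + 1 - c\<close> and takes a value at most
  \<open>- c\<close> at some vertex, so its values at the other vertices sum to at least \<open>k + 1\<close>.  Hence it
  cannot lie below an effective divisor of smaller degree.
\<close>

lemma real_gonality_le_dual:
  assumes conn: "connected_multigraph V E"
    and c: "2 * real (size E) - real (card V) * c = real (size E) + (real k + 1) - c"
  shows "real_gonality V E k \<le> real (size E) + (real k + 1) - c - real (card V)"
proof -
  have mg: "multigraph V E" and fin: "finite V" "V \<noteq> {}"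
    using conn by (auto simp: connected_multigraph_def multigraph_def)
  define D where "D v = (if v \<in> V then valency V E v - c else 0)" for v
  have D: "D \<in> divisors V"
    by (simp add: D_def divisors_def)
  have deg: "div_degree V D = real (size E) + (real k + 1) - c"
    using c by (simp add: D_def div_degree_def sum_subtractf sum_valency[OF mg])
  have "real_gonality V E k \<le> div_degree V D - real (card V)"
  proof (rule real_gonality_le[OF fin D])
    fix F assume F: "F \<in> effective_divisors V" "div_degree V F < real k + 1"
    show "linear_system V E (\<lambda>v. D v - F v) \<noteq> {}"
    proof
      assume empty: "linear_system V E (\<lambda>v. D v - F v) = {}"
      have "(\<lambda>v. D v - F v) \<in> divisors V"
        using D F(1) by (auto simp: divisors_def effective_divisors_def)
      then obtain \<sigma> f where inj: "inj_on \<sigma> V"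
        and less: "\<And>v. v \<in> V \<Longrightarrow> D v - F v - principal_divisor V E f v < indegree V E \<sigma> v"
        using empty_linear_system_dominated[OF conn _ empty] by blast
      define x where "x v = D v - indegree V E \<sigma> v - principal_divisor V E f v" for v
      obtain v where v: "v \<in> V" "valency V E v \<le> indegree V E \<sigma> v + principal_divisor V E f v"
        using exists_valency_le_indegree_plus_principal[OF mg fin(2) inj] by blast
      have "x v \<le> - c"
        using v by (simp add: x_def D_def)
      moreover have "(\<Sum>u\<in>V. x u) = real k + 1 - c"
        using deg by (simp add: x_def sum_subtractf sum_principal_divisor
            sum_indegree[OF mg inj] div_degree_def)
      moreover have "(\<Sum>u\<in>V. x u) = x v + (\<Sum>u\<in>V - {v}. x u)"
        using fin(1) v(1) by (rule sum.remove)
      moreover have "(\<Sum>u\<in>V - {v}. x u) \<le> (\<Sum>u\<in>V - {v}. F u)"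
        using less by (intro sum_mono) (force simp: x_def)
      moreover have "(\<Sum>u\<in>V - {v}. F u) \<le> div_degree V F"
        unfolding div_degree_def using fin(1) F(1)
        by (intro sum_mono2) (auto simp: effective_divisors_def)
      ultimately show False
        using F(2) by linarith
    qed
  qed
  then show ?thesis by (simp add: deg)
qed


section \<open>The gonality bound\<close>

text \<open>
  If \<open>\<kappa> y \<ge> N\<close>, the difference of the two sides is at least \<open>(x - 1) (\<kappa> y - N)\<close>; otherwise
  the left-hand side is at most \<open>(N + 1) y \<le> (N + 1) N / \<kappa>\<close>.
\<close>

lemma weighted_sum_le:
  fixes N m \<kappa> x y :: real
  assumes "1 \<le> x" "x \<le> y" "1 \<le> \<kappa>" "0 \<le> N" "N * (N + 1) \<le> \<kappa> * m" "\<kappa> * x * y \<le> m - N"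
  shows "N * x + y \<le> m"
proof (cases "N \<le> \<kappa> * y")
  case True
  have "0 \<le> (x - 1) * (\<kappa> * y - N)"
    using assms(1) True by simp
  moreover have "0 \<le> (\<kappa> - 1) * y"
    using assms by simp
  ultimately show ?thesis
    using assms(6) by (simp add: algebra_simps)
next
  case False
  have "\<kappa> * (N * x + y) \<le> \<kappa> * ((N + 1) * y)"
    using assms mult_left_mono[of x y N] by (intro mult_left_mono) (auto simp: algebra_simps)
  also have "\<dots> = (N + 1) * (\<kappa> * y)"
    by simp
  also have "\<dots> \<le> (N + 1) * N"
    using False assms(4) by (intro mult_left_mono) auto
  also have "\<dots> \<le> \<kappa> * m"
    using assms(5) by (simp add: mult.commute)
  finally show ?thesis
    using assms(3) by simp
qed

theorem corollary4p14:
  fixes V :: "'a set" and E :: "'a set multiset" and k :: nat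
  assumes "connected_multigraph V E"
    and "2 \<le> card V"
    and "1 \<le> genus V E"
    and "1 \<le> k"
  shows "real_gonality V E k \<le>
    real_of_int \<lceil>real_of_int (genus V E) * (real_of_int (stretch_factor V E) * (real k + 1) - 1)
                   / (real_of_int (stretch_factor V E) * (real k + 1)) + real k\<rceil>"
proof -
  define a where "a = real k + 1"
  define \<kappa> where "\<kappa> = real_of_int (stretch_factor V E)"
  define g where "g = real_of_int (genus V E)"
  define N where "N = real (card V) - 1"
  define m where "m = real (size E)"
  define b where "b = \<lfloor>g / (\<kappa> * a)\<rfloor>"
  have fin: "finite V" "V \<noteq> {}"
    using assms(1) by (auto simp: connected_multigraph_def multigraph_def)
  have a1: "1 \<le> a" and N1: "1 \<le> N" and g1: "1 \<le> g" and \<kappa>1: "1 \<le> \<kappa>"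
    using assms(2,3) by (auto simp: a_def N_def g_def \<kappa>_def stretch_factor_def)
  have g: "g = m - N"
    by (simp add: g_def m_def N_def genus_def)
  then have m: "0 < m"
    using N1 g1 by simp
  have pos: "0 < \<kappa> * a"
    using \<kappa>1 a1 by simp
  have "(N + 1) * N / m \<le> \<kappa>"
    unfolding \<kappa>_def stretch_factor_def N_def m_def by (simp add: le_max_iff_disj) linarith
  then have \<kappa>m: "N * (N + 1) \<le> \<kappa> * m"
    using m by (simp add: pos_divide_le_eq mult.commute)
  have "real_of_int b * (\<kappa> * a) \<le> g"
    unfolding b_def pos_le_divide_eq[OF pos, symmetric] by (rule of_int_floor_le)
  then have ab: "\<kappa> * a * b \<le> m - N"
    by (simp add: g mult.commute)
  have "0 \<le> b"
    using g1 pos by (simp add: b_def)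
  have "g * (\<kappa> * a - 1) / (\<kappa> * a) + real k = - (g / (\<kappa> * a)) + of_int (genus V E + int k)"
    using \<kappa>1 a1 by (simp add: right_diff_distrib diff_divide_distrib g_def)
  then have "\<lceil>g * (\<kappa> * a - 1) / (\<kappa> * a) + real k\<rceil> = - b + (genus V E + int k)"
    by (simp only: ceiling_add_of_int ceiling_minus b_def)
  then have rhs: "real_of_int \<lceil>g * (\<kappa> * a - 1) / (\<kappa> * a) + real k\<rceil> = m + a - b - (N + 1)"
    using g by (simp add: g_def a_def)
  have "real_gonality V E k \<le> m + a - b - (N + 1)"
  proof -
    consider "b = 0" | "1 \<le> b" "a \<le> b" | "1 \<le> b" "b \<le> a"
      using \<open>0 \<le> b\<close> by linarith
    then show ?thesis
    proof cases
      case 1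
      then show ?thesis
        using real_gonality_le_trivial[OF assms(1), of k] by (simp add: m_def a_def N_def)
    next
      case 2
      have "N * a + b \<le> m"
        by (rule weighted_sum_le[of _ _ \<kappa>]) (use 2 a1 \<kappa>1 N1 \<kappa>m ab in auto)
      then show ?thesis
        using real_gonality_le_constant[OF fin, of E k] by (simp add: a_def N_def algebra_simps)
    next
      case 3
      have "N * b + a \<le> m"
        by (rule weighted_sum_le[of _ _ \<kappa>]) (use 3 a1 \<kappa>1 N1 \<kappa>m ab in \<open>auto simp: mult_ac\<close>)
      define c where "c = (m - a) / N"
      have "b \<le> c"
        using \<open>N * b + a \<le> m\<close> N1 by (simp add: c_def pos_le_divide_eq mult.commute)
      have "N * c = m - a"
        using N1 by (simp add: c_def)
      then have "2 * m - (N + 1) * c = m + a - c"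
        by (simp add: algebra_simps)
      then have "real_gonality V E k \<le> m + a - c - (N + 1)"
        using real_gonality_le_dual[OF assms(1), of c k] by (simp add: m_def a_def N_def)
      then show ?thesis
        using \<open>b \<le> c\<close> by simp
    qed
  qed
  then show ?thesis
    using rhs by (simp only: g_def \<kappa>_def a_def)
qed

end
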